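(* Fix $d\geq1$ and let $X=\mathbb{N}^d$. For all $x\in X$ and all $1\leq j'<j\leq d$, we have $g_{j'}(g_j(x))=g_j(g_{j'}(x))$.
   Context: $\mathbb{N}$ denotes the nonnegative integers and $[d]=\{1,\dots,d\}$. For $x=(n_1,\dots,n_d)\in X$ let $\Delta(x)=\{(1,n_1),\dots,(d,n_d)\}\subseteq[d]\times\mathbb{N}$; conversely any set of $d$ points of $[d]\times\mathbb{N}$ with pairwise distinct first coordinates determines an element of $X$. For $\delta=(i,n)\in[d]\times\mathbb{N}$ the seat is $i(\delta)=i$ and the height is $h(\delta)=n+i/d$; points are linearly ordered by height ($\delta_1\prec\delta_2$ iff $h(\delta_1)<h(\delta_2)$). For $s\in\mathbb{N}$, $\delta+s/d$ denotes the unique point of $[d]\times\mathbb{N}$ of height $h(\delta)+s/d$. List $\Delta(x)=\{\delta^1(x)\prec\cdots\prec\delta^d(x)\}$. For $j\in[d]$, the operator $g_j:X\to X$ is defined by $g_j(x)=x'$ where $\Delta(x')=\{\delta^k(x'):k\in[d]\}$ with $\delta^k(x')=\delta^k(x)$ for $k<j$ and $\delta^k(x')=\delta^k(x)+s_k/d$ for $k\geq j$, where $s_k$ is the smallest positive integer such that $i(\delta^k(x)+s_k/d)\in\{i(\delta^j(x)),\dots,i(\delta^d(x))\}$. (In particular $g_1(n_1,\dots,n_d)=(n_d+1,n_1,\dots,n_{d-1})$.) *)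

theory Defs
  imports Complex_Main "HOL-Library.FuncSet"
begin

text \<open>
  Points of $[d] \times \mathbb{N}$ are pairs (seat, coordinate). A tuple
  $(n_1,\dots,n_d)$ is a function on the indices \<open>1,\<dots>,d\<close>, extensional
  (\<open>undefined\<close> off \<open>{1..d}\<close>) so that equality of tuples is equality of functions.
\<close>

type_synonym point = "nat \<times> nat"

definition tuples :: "nat \<Rightarrow> (nat \<Rightarrow> nat) set" where
  "tuples d = {1..d} \<rightarrow>\<^sub>E UNIV"

definition points :: "nat \<Rightarrow> point set" where
  "points d = {1..d} \<times> UNIV"

definition Delta :: "nat \<Rightarrow> (nat \<Rightarrow> nat) \<Rightarrow> point set" where
  "Delta d x = (\<lambda>i. (i, x i)) ` {1..d}"

definition seat :: "point \<Rightarrow> nat" where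
  "seat p = fst p"

definition height :: "nat \<Rightarrow> point \<Rightarrow> real" where
  "height d p = real (snd p) + real (fst p) / real d"

definition shift :: "nat \<Rightarrow> point \<Rightarrow> nat \<Rightarrow> point" where
  "shift d p s = (THE q. q \<in> points d \<and> height d q = height d p + real s / real d)"

definition listing :: "nat \<Rightarrow> (nat \<Rightarrow> nat) \<Rightarrow> point list" where
  "listing d x = (THE ps. set ps = Delta d x \<and> sorted_wrt (\<lambda>p q. height d p < height d q) ps)"

text \<open>\<open>delta d x k\<close> is $\delta^k(x)$, with \<open>k\<close> counted from 1.\<close>

definition delta :: "nat \<Rightarrow> (nat \<Rightarrow> nat) \<Rightarrow> nat \<Rightarrow> point" where
  "delta d x k = listing d x ! (k - 1)"

definition step :: "nat \<Rightarrow> nat \<Rightarrow> (nat \<Rightarrow> nat) \<Rightarrow> nat \<Rightarrow> nat" where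
  "step d j x k =
     (LEAST s. 0 < s \<and> seat (shift d (delta d x k) s) \<in> (\<lambda>l. seat (delta d x l)) ` {j..d})"

definition moved :: "nat \<Rightarrow> nat \<Rightarrow> (nat \<Rightarrow> nat) \<Rightarrow> nat \<Rightarrow> point" where
  "moved d j x k =
     (if k < j then delta d x k else shift d (delta d x k) (step d j x k))"

definition g :: "nat \<Rightarrow> nat \<Rightarrow> (nat \<Rightarrow> nat) \<Rightarrow> nat \<Rightarrow> nat" where
  "g d j x = (THE x'. x' \<in> tuples d \<and> Delta d x' = moved d j x ` {1..d})"

text \<open>
  The rest shows that the definite descriptions above denote, that \<open>g d j\<close> maps
  \<open>tuples d\<close> to itself, that \<open>moved d j x k\<close> is $\delta^k(g_j(x))$ (the moved
  points are again enumerated by increasing height), and that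
  $g_1(n_1,\dots,n_d)=(n_d+1,n_1,\dots,n_{d-1})$.
\<close>

text \<open>\<open>pos d p\<close> is the height in units of $1/d$.\<close>

definition pos :: "nat \<Rightarrow> point \<Rightarrow> nat" where
  "pos d p = snd p * d + fst p"

lemma height_pos: "d \<ge> 1 \<Longrightarrow> height d p = real (pos d p) / real d"
  by (simp add: height_def pos_def field_simps)

lemma height_less_iff: "d \<ge> 1 \<Longrightarrow> height d p < height d q \<longleftrightarrow> pos d p < pos d q"
  by (simp add: height_pos divide_less_cancel)

lemma seat_pos:
  assumes "p \<in> points d"
  shows "seat p = (pos d p - 1) mod d + 1" "snd p = (pos d p - 1) div d"
proof -
  obtain i n where p: "p = (i, n)" "1 \<le> i" "i \<le> d"
    using assms by (auto simp: points_def)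
  have "pos d p - 1 = (i - 1) + n * d"
    using p by (simp add: pos_def)
  moreover have "i - 1 < d" "d > 0" using p by auto
  ultimately have "(pos d p - 1) mod d = i - 1" "(pos d p - 1) div d = n"
    by simp_all
  then show "seat p = (pos d p - 1) mod d + 1" "snd p = (pos d p - 1) div d"
    using p by (simp_all add: seat_def)
qed

lemma inj_on_pos: "inj_on (pos d) (points d)"
  by (intro inj_onI prod_eqI) (metis seat_pos(1) seat_def, metis seat_pos(2))

lemma shift_props:
  assumes d: "d \<ge> 1" and p: "p \<in> points d"
  shows "shift d p s \<in> points d" "height d (shift d p s) = height d p + real s / real d"
    "pos d (shift d p s) = pos d p + s"
proof -
  let ?P = "\<lambda>q. q \<in> points d \<and> height d q = height d p + real s / real d"
  have *: "height d q = height d p + real s / real d \<longleftrightarrow> pos d q = pos d p + s" for q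
  proof -
    have "height d p + real s / real d = real (pos d p + s) / real d"
      using d by (simp add: height_pos add_divide_distrib)
    then show ?thesis
      using d by (simp only: height_pos divide_cancel_right of_nat_eq_iff) simp
  qed
  let ?m = "pos d p + s - 1"
  let ?q = "(?m mod d + 1, ?m div d)"
  have "pos d p \<ge> 1" using p by (auto simp: pos_def points_def)
  then have "pos d ?q = pos d p + s"
    by (simp add: pos_def)
  moreover have "?q \<in> points d"
    using d by (simp add: points_def Suc_le_eq)
  ultimately have "?P ?q" using * by blast
  moreover have "q = ?q" if "?P q" for q
    using that \<open>?P ?q\<close> * inj_on_pos[of d] unfolding inj_on_def by metis
  ultimately have "?P (shift d p s)"
    unfolding shift_def by (rule theI)
  then show "shift d p s \<in> points d" "height d (shift d p s) = height d p + real s / real d"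
    "pos d (shift d p s) = pos d p + s"
    using * by blast+
qed

lemma Delta_points: "Delta d x \<subseteq> points d"
  by (auto simp: Delta_def points_def)

lemma card_Delta: "card (Delta d x) = d" "finite (Delta d x)"
  by (auto simp: Delta_def card_image inj_on_def)

lemma listing_unique:
  assumes d: "d \<ge> 1"
    and "set ps = Delta d x" "sorted_wrt (\<lambda>p q. height d p < height d q) ps"
    and "set qs = Delta d x" "sorted_wrt (\<lambda>p q. height d p < height d q) qs"
  shows "ps = qs"
proof -
  have "sorted_wrt (<) (map (pos d) ps)" "sorted_wrt (<) (map (pos d) qs)"
    using assms by (simp_all add: sorted_wrt_map height_less_iff)
  moreover have "set (map (pos d) ps) = set (map (pos d) qs)"
    using assms by simp
  ultimately have "map (pos d) ps = map (pos d) qs"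
    by (simp add: strict_sorted_equal)
  moreover have "inj_on (pos d) (set ps \<union> set qs)"
    using assms Delta_points inj_on_pos inj_on_subset by (metis Un_absorb)
  ultimately show ?thesis
    using inj_on_map_eq_map by blast
qed

lemma listing_props:
  assumes d: "d \<ge> 1"
  shows "set (listing d x) = Delta d x"
    "sorted_wrt (\<lambda>p q. height d p < height d q) (listing d x)"
    "length (listing d x) = d"
proof -
  let ?P = "\<lambda>ps. set ps = Delta d x \<and> sorted_wrt (\<lambda>p q. height d p < height d q) ps"
  let ?N = "pos d ` Delta d x"
  let ?f = "inv_into (Delta d x) (pos d)"
  let ?ps = "map ?f (sorted_list_of_set ?N)"
  have fin: "finite ?N" by (simp add: card_Delta)
  have inj: "inj_on (pos d) (Delta d x)"
    using inj_on_subset[OF inj_on_pos Delta_points] .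
  have "set ?ps = Delta d x"
    using fin inj by (simp add: image_image)
  moreover have "sorted_wrt (\<lambda>p q. pos d p < pos d q) ?ps"
    unfolding sorted_wrt_map
    by (rule sorted_wrt_mono_rel[OF _ strict_sorted_list_of_set])
       (use fin in \<open>simp add: f_inv_into_f\<close>)
  ultimately have "?P ?ps" using d by (simp add: height_less_iff)
  then have "?P (listing d x)"
    unfolding listing_def by (rule theI) (use listing_unique[OF d] \<open>?P ?ps\<close> in blast)
  then show 1: "set (listing d x) = Delta d x"
    and 2: "sorted_wrt (\<lambda>p q. height d p < height d q) (listing d x)" by auto
  have "sorted_wrt (<) (map (pos d) (listing d x))"
    using 2 d by (simp add: sorted_wrt_map height_less_iff)
  then have "distinct (listing d x)"
    by (simp add: strict_sorted_iff distinct_map)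
  then show "length (listing d x) = d"
    using 1 card_Delta by (metis distinct_card)
qed

lemma delta_props:
  assumes d: "d \<ge> 1"
  shows "delta d x ` {1..d} = Delta d x"
    "\<And>k l. 1 \<le> k \<Longrightarrow> k < l \<Longrightarrow> l \<le> d \<Longrightarrow> height d (delta d x k) < height d (delta d x l)"
proof -
  have "delta d x ` {1..d} = (!) (listing d x) ` ((\<lambda>k. k - 1) ` {1..d})"
    by (simp add: delta_def image_image)
  also have "(\<lambda>k. k - 1) ` {1..d} = {0..<d}"
    using image_minus_const_atLeastLessThan_nat[of 1 1 "Suc d"] d
    by (simp add: atLeastLessThanSuc_atLeastAtMost)
  also have "(!) (listing d x) ` {0..<d} = Delta d x"
    using nth_image[of d "listing d x"] listing_props[OF d] by (simp add: atLeast0LessThan)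
  finally show "delta d x ` {1..d} = Delta d x" .
  fix k l assume "1 \<le> k" "k < l" "l \<le> d"
  then show "height d (delta d x k) < height d (delta d x l)"
    unfolding delta_def using listing_props[OF d]
    by (intro sorted_wrt_nth_less[where P = "\<lambda>p q. height d p < height d q"]) auto
qed

lemma tuple_of_points:
  assumes "D \<subseteq> points d" "inj_on seat D" "card D = d"
  shows "\<exists>!x. x \<in> tuples d \<and> Delta d x = D"
proof -
  have "finite {1..d}" "seat ` D \<subseteq> {1..d}"
    using assms(1) by (auto simp: points_def seat_def)
  moreover have "card (seat ` D) = card {1..d}"
    using assms by (simp add: card_image)
  ultimately have S: "seat ` D = {1..d}"
    by (rule card_subset_eq)
  have "\<forall>i\<in>{1..d}. \<exists>n. (i, n) \<in> D"
    using S by (force simp: seat_def)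
  then obtain y where y: "\<forall>i\<in>{1..d}. (i, y i) \<in> D" by metis
  have u: "n = y i" if "(i, n) \<in> D" for i n
  proof -
    have "i \<in> {1..d}" using that S by (force simp: seat_def)
    then have "(i, y i) \<in> D" using y by blast
    then show ?thesis using inj_onD[OF assms(2), of "(i, n)" "(i, y i)"] that
      by (simp add: seat_def)
  qed
  show ?thesis
  proof (rule ex1I[of _ "restrict y {1..d}"])
    have "Delta d (restrict y {1..d}) = D"
    proof
      show "Delta d (restrict y {1..d}) \<subseteq> D" using y by (auto simp: Delta_def)
      show "D \<subseteq> Delta d (restrict y {1..d})"
      proof
        fix p assume "p \<in> D"
        moreover obtain i n where "p = (i, n)" by (cases p)
        moreover have "i \<in> {1..d}" using calculation S by (force simp: seat_def)
        ultimately show "p \<in> Delta d (restrict y {1..d})"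
          using u by (auto simp: Delta_def)
      qed
    qed
    then show "restrict y {1..d} \<in> tuples d \<and> Delta d (restrict y {1..d}) = D"
      by (simp add: tuples_def)
  next
    fix x assume x: "x \<in> tuples d \<and> Delta d x = D"
    have "x i = restrict y {1..d} i" for i
    proof (cases "i \<in> {1..d}")
      case True
      then have "(i, x i) \<in> D" using x by (auto simp: Delta_def)
      then show ?thesis using u True by simp
    next
      case False
      then show ?thesis using x by (auto simp: tuples_def PiE_def extensional_def)
    qed
    then show "x = restrict y {1..d}" by blast
  qed
qed

lemma add_mod_cancel: "(a + c) mod d = (b + c) mod d \<Longrightarrow> a mod d = b mod d" for a b c d :: nat
  by (auto simp: nat_mod_eq_iff)

lemma g_props:
  assumes d: "d \<ge> 1" and j: "1 \<le> j" "j \<le> d"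
  shows "g d j x \<in> tuples d"
    and "Delta d (g d j x) = moved d j x ` {1..d}"
    and "\<And>k. 1 \<le> k \<Longrightarrow> k \<le> d \<Longrightarrow> delta d (g d j x) k = moved d j x k"
proof -
  let ?S = "(\<lambda>l. seat (delta d x l)) ` {j..d}"
  let ?m = "moved d j x"
  let ?s = "step d j x"
  have P: "delta d x k \<in> points d" if "1 \<le> k" "k \<le> d" for k
    using that delta_props(1)[OF d, of x] Delta_points[of d x] by auto
  have pm: "pos d (delta d x k) < pos d (delta d x l)" if "1 \<le> k" "k < l" "l \<le> d" for k l
    using delta_props(2)[OF d that] d by (simp add: height_less_iff)
  have inj\<delta>: "inj_on (\<lambda>l. seat (delta d x l)) {1..d}"
  proof (rule inj_onI)
    fix k l assume kl: "k \<in> {1..d}" "l \<in> {1..d}" "seat (delta d x k) = seat (delta d x l)"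
    have "delta d x k \<in> Delta d x" "delta d x l \<in> Delta d x"
      using delta_props(1)[OF d, of x] kl by blast+
    then have "delta d x k = delta d x l" using kl(3) by (auto simp: Delta_def seat_def)
    then show "k = l" using pm[of k l] pm[of l k] kl by (metis atLeastAtMost_iff linorder_neqE_nat less_irrefl)
  qed
  have sp: "seat (shift d p s) = (pos d p + s - 1) mod d + 1" if "p \<in> points d" for p s
    using seat_pos(1)[OF shift_props(1)[OF d that]] shift_props(3)[OF d that] by simp
  have pos1: "pos d p \<ge> 1" if "p \<in> points d" for p
    using that by (auto simp: points_def pos_def)
  have s: "0 < ?s k" "seat (shift d (delta d x k) (?s k)) \<in> ?S" if "j \<le> k" "k \<le> d" for k
  proof -
    have pk: "delta d x k \<in> points d" using P that j by simp
    have "pos d (delta d x k) + d - 1 = (pos d (delta d x k) - 1) + d"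
      using pos1[OF pk] by simp
    then have "seat (shift d (delta d x k) d) = seat (delta d x k)"
      unfolding sp[OF pk] seat_pos(1)[OF pk] by (simp only: mod_add_self2)
    then have "0 < d \<and> seat (shift d (delta d x k) d) \<in> ?S"
      using that d by auto
    from LeastI[of "\<lambda>s. 0 < s \<and> seat (shift d (delta d x k) s) \<in> ?S", OF this]
    show "0 < ?s k" "seat (shift d (delta d x k) (?s k)) \<in> ?S"
      unfolding step_def by auto
  qed
  have min: "?s k \<le> t" if "0 < t" "seat (shift d (delta d x k) t) \<in> ?S" for k t
    unfolding step_def using that by (intro Least_le) auto
  have mP: "?m k \<in> points d" if "1 \<le> k" "k \<le> d" for k
    using shift_props(1)[OF d P[OF that]] P[OF that] by (simp add: moved_def)
  have mono: "pos d (?m k) < pos d (?m l)" if kl: "1 \<le> k" "k < l" "l \<le> d" for k l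
  proof (cases "j \<le> k")
    case True
    have pk: "delta d x k \<in> points d" and pl: "delta d x l \<in> points d" using P kl by auto
    let ?t = "pos d (delta d x l) - pos d (delta d x k)"
    have t: "0 < ?t" "pos d (delta d x k) + ?t = pos d (delta d x l)" using pm[OF kl] by auto
    have "seat (shift d (delta d x k) ?t) = seat (delta d x l)"
      using sp[OF pk, of ?t] seat_pos(1)[OF pl] t(2) by simp
    then have "?s k \<le> ?t" using min t kl True by auto
    moreover have "0 < ?s l" using s kl True by simp
    ultimately show ?thesis
      using True kl t shift_props(3)[OF d pk] shift_props(3)[OF d pl] by (simp add: moved_def)
  next
    case False
    have pl: "delta d x l \<in> points d" using P kl by auto
    have "pos d (delta d x l) \<le> pos d (?m l)"
      using shift_props(3)[OF d pl] by (simp add: moved_def)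
    then show ?thesis using False pm[OF kl] by (simp add: moved_def)
  qed
  have noteq: "?s k < ?s l \<Longrightarrow> seat (?m k) \<noteq> seat (?m l)" 
    if "j \<le> k" "k \<le> d" "j \<le> l" "l \<le> d" for k l
  proof
    assume lt: "?s k < ?s l" and eq: "seat (?m k) = seat (?m l)"
    have pk: "delta d x k \<in> points d" and pl: "delta d x l \<in> points d" using P that j by auto
    have "(pos d (delta d x k) + ?s k - 1) mod d = (pos d (delta d x l) + ?s l - 1) mod d"
      using eq that sp[OF pk] sp[OF pl] by (simp add: moved_def)
    moreover have "pos d (delta d x k) + ?s k - 1 = (pos d (delta d x k) - 1) + ?s k"
      using pos1[OF pk] by simp
    moreover have "pos d (delta d x l) + ?s l - 1
        = (pos d (delta d x l) + (?s l - ?s k) - 1) + ?s k"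
      using pos1[OF pl] lt by simp
    ultimately have "(pos d (delta d x k) - 1) mod d
        = (pos d (delta d x l) + (?s l - ?s k) - 1) mod d"
      by (metis add_mod_cancel)
    then have "seat (shift d (delta d x l) (?s l - ?s k)) = seat (delta d x k)"
      using sp[OF pl] seat_pos(1)[OF pk] by simp
    then have "?s l \<le> ?s l - ?s k" using min[of "?s l - ?s k" l] lt that by auto
    then show False using lt s(1)[of k] that by simp
  qed
  have injm: "inj_on (\<lambda>k. seat (?m k)) {1..d}"
  proof (rule inj_onI)
    fix k l assume kl: "k \<in> {1..d}" "l \<in> {1..d}" and eq: "seat (?m k) = seat (?m l)"
    have out: "seat (delta d x k) \<notin> ?S" if "k \<in> {1..d}" "k < j" for k
    proof
      assume "seat (delta d x k) \<in> ?S"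
      then obtain l where l: "l \<in> {j..d}" "seat (delta d x k) = seat (delta d x l)" by blast
      then have "k = l" using inj_onD[OF inj\<delta>, of k l] that j by simp
      then show False using l that by simp
    qed
    have ins: "seat (?m k) \<in> ?S" if "k \<in> {1..d}" "\<not> k < j" for k
      using that s(2)[of k] by (simp add: moved_def)
    show "k = l"
    proof (cases "k < j \<or> l < j")
      case True
      then have "k < j" "l < j"
        using eq kl out[of k] out[of l] ins[of k] ins[of l]
        unfolding moved_def by metis+
      then show ?thesis using eq inj_onD[OF inj\<delta> _ kl(1,2)] by (simp add: moved_def)
    next
      case False
      then have "?s k = ?s l"
        using noteq[of k l] noteq[of l k] eq kl by (cases "?s k" "?s l" rule: linorder_cases) auto
      have pk: "delta d x k \<in> points d" and pl: "delta d x l \<in> points d" using P kl by auto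
      have "(pos d (delta d x k) + ?s k - 1) mod d = (pos d (delta d x l) + ?s k - 1) mod d"
        using eq False \<open>?s k = ?s l\<close> sp[OF pk] sp[OF pl] by (simp add: moved_def)
      then have "((pos d (delta d x k) - 1) + ?s k) mod d = ((pos d (delta d x l) - 1) + ?s k) mod d"
        using pos1[OF pk] pos1[OF pl] by simp
      then have "(pos d (delta d x k) - 1) mod d = (pos d (delta d x l) - 1) mod d"
        by (rule add_mod_cancel)
      then have "seat (delta d x k) = seat (delta d x l)"
        using seat_pos(1)[OF pk] seat_pos(1)[OF pl] by simp
      then show ?thesis using inj_onD[OF inj\<delta> _ kl(1,2)] by simp
    qed
  qed
  have "inj_on seat (?m ` {1..d})"
    using inj_on_imageI[of seat ?m] injm by (simp add: o_def)
  moreover have "card (?m ` {1..d}) = d"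
    using inj_on_imageI2[of seat ?m] injm by (simp add: card_image o_def)
  moreover have "?m ` {1..d} \<subseteq> points d" using mP by auto
  ultimately have "\<exists>!x'. x' \<in> tuples d \<and> Delta d x' = ?m ` {1..d}"
    by (intro tuple_of_points) auto
  from theI'[OF this] show 1: "g d j x \<in> tuples d" and 2: "Delta d (g d j x) = ?m ` {1..d}"
    unfolding g_def by auto
  have "sorted_wrt (\<lambda>p q. height d p < height d q) (map ?m [1..<Suc d])"
    unfolding sorted_wrt_map
    by (rule sorted_wrt_mono_rel[OF _ sorted_wrt_upt])
       (simp add: height_less_iff[OF d] mono del: upt_Suc)
  moreover have "set (map ?m [1..<Suc d]) = Delta d (g d j x)"
    unfolding 2 set_map set_upt atLeastLessThanSuc_atLeastAtMost ..
  ultimately have L: "listing d (g d j x) = map ?m [1..<Suc d]"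
    by (intro listing_unique[OF d listing_props(1,2)[OF d]])
  show "delta d (g d j x) k = ?m k" if "1 \<le> k" "k \<le> d" for k
    using that by (simp add: delta_def L del: upt_Suc)
qed

lemma g_1:
  assumes d: "d \<ge> 1"
  shows "g d 1 x = (\<lambda>i\<in>{1..d}. if i = 1 then x d + 1 else x (i - 1))"
proof -
  let ?y = "\<lambda>i\<in>{1..d}. if i = 1 then x d + 1 else x (i - 1)"
  have P: "delta d x k \<in> points d" if "k \<in> {1..d}" for k
    using that delta_props(1)[OF d, of x] Delta_points[of d x] by auto
  have S: "(\<lambda>l. seat (delta d x l)) ` {1..d} = {1..d}"
  proof -
    have "(\<lambda>l. seat (delta d x l)) ` {1..d} = seat ` (delta d x ` {1..d})"
      by (simp add: image_image)
    then show ?thesis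
      unfolding delta_props(1)[OF d] by (simp add: Delta_def seat_def image_image)
  qed
  have "step d 1 x k = 1" if "k \<in> {1..d}" for k
    unfolding step_def S
    using shift_props(1)[OF d P[OF that], of 1]
    by (intro Least_equality) (auto simp: points_def seat_def)
  then have "moved d 1 x ` {1..d} = (\<lambda>p. shift d p 1) ` (delta d x ` {1..d})"
    by (auto simp: moved_def image_image)
  also have "\<dots> = (\<lambda>i. shift d (i, x i) 1) ` {1..d}"
    unfolding delta_props(1)[OF d] by (simp add: Delta_def image_image)
  also have "\<dots> = (\<lambda>i. if i = d then (1, x d + 1) else (i + 1, x i)) ` {1..d}"
  proof (rule image_cong[OF refl])
    fix i assume i: "i \<in> {1..d}"
    then have p: "(i, x i) \<in> points d" by (simp add: points_def)
    let ?q = "if i = d then (1, x d + 1) else (i + 1, x i)"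
    have "?q \<in> points d" using i by (auto simp: points_def)
    moreover have "pos d ?q = pos d (shift d (i, x i) 1)"
      using shift_props(3)[OF d p, of 1] by (simp add: pos_def)
    ultimately show "shift d (i, x i) 1 = ?q"
      using shift_props(1)[OF d p, of 1] by (intro inj_onD[OF inj_on_pos[of d]]) simp_all
  qed
  also have "\<dots> = Delta d ?y"
  proof
    show "(\<lambda>i. if i = d then (1, x d + 1) else (i + 1, x i)) ` {1..d} \<subseteq> Delta d ?y"
    proof
      fix p assume "p \<in> (\<lambda>i. if i = d then (1, x d + 1) else (i + 1, x i)) ` {1..d}"
      then obtain i where i: "i \<in> {1..d}" "p = (if i = d then (1, x d + 1) else (i + 1, x i))"
        by blast
      show "p \<in> Delta d ?y"
      proof (cases "i = d")
        case True
        then show ?thesis using i d unfolding Delta_def by (intro image_eqI[of _ _ 1]) auto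
      next
        case False
        then show ?thesis using i unfolding Delta_def by (intro image_eqI[of _ _ "i + 1"]) auto
      qed
    qed
    show "Delta d ?y \<subseteq> (\<lambda>i. if i = d then (1, x d + 1) else (i + 1, x i)) ` {1..d}"
    proof
      fix p assume "p \<in> Delta d ?y"
      then obtain i where i: "i \<in> {1..d}" "p = (i, ?y i)" by (auto simp: Delta_def)
      show "p \<in> (\<lambda>i. if i = d then (1, x d + 1) else (i + 1, x i)) ` {1..d}"
      proof (cases "i = 1")
        case True
        then show ?thesis using i d by (intro image_eqI[of _ _ d]) auto
      next
        case False
        then show ?thesis using i by (intro image_eqI[of _ _ "i - 1"]) auto
      qed
    qed
  qed
  finally have "moved d 1 x ` {1..d} = Delta d ?y" .
  then have *: "Delta d (g d 1 x) = Delta d ?y" using g_props(2)[OF d, of 1] d by simp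
  have t: "g d 1 x \<in> tuples d" using g_props(1)[OF d, of 1] d by simp
  have "g d 1 x i = ?y i" if "i \<in> {1..d}" for i
  proof -
    have "(i, g d 1 x i) \<in> Delta d ?y" unfolding *[symmetric] using that by (auto simp: Delta_def)
    then show ?thesis by (auto simp: Delta_def)
  qed
  then show ?thesis
    using t by (auto simp: tuples_def PiE_def extensional_def fun_eq_iff)
qed

end

theory Submission
  imports Defs
begin

text \<open>
  In units of $1/d$, heights are natural numbers and seats are residues modulo $d$. The
  operator $g_j$ moves every particle $k \geq j$ to the next position whose residue lies in
  the set of residues of the particles $j,\dots,d$. Let $A \supseteq B$ be the residue sets
  belonging to $j' < j$, and let $N_A$, $N_B$ be the corresponding successor maps. Applying
  $g_j$ first leaves both $A$ and $B$ invariant, while applying $g_{j'}$ first replaces $B$ by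
  $B' = N_A(B)$. As $N_A$ is strictly increasing on the positions with residue in $A$, it
  intertwines the successor maps of $B$ and $B'$, that is $N_{B'} \circ N_A = N_A \circ N_B$.
\<close>

definition next_pos :: "nat \<Rightarrow> nat set \<Rightarrow> nat \<Rightarrow> nat" where
  "next_pos d R p = p + (LEAST s. 0 < s \<and> (p + s) mod d \<in> R)"

text \<open>Full periods pass through the successor map. This turns congruences mod \<open>d\<close>
  into equations between positions in \<open>next_pos_commute\<close>.\<close>

lemma next_pos_add: "next_pos d R (p + t * d) = next_pos d R p + t * d"
proof -
  have "(p + t * d + s) mod d = (p + s) mod d" for s
    by (metis add.assoc add.commute mod_mult_self1)
  then show ?thesis by (simp add: next_pos_def)
qed

text \<open>Makes the map well defined on residues, so it sends every position with residue in
  \<open>B\<close>, not just the listed \<open>f l\<close>, into \<open>B'\<close>.\<close>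

lemma next_pos_mod_cong:
  assumes "p mod d = q mod d"
  shows "next_pos d R p mod d = next_pos d R q mod d"
proof -
  have "(p + s) mod d = (q + s) mod d" for s
    using assms by (intro mod_add_cong) auto
  then show ?thesis unfolding next_pos_def by simp
qed

lemma next_pos_props:
  assumes "d \<ge> 1" "p mod d \<in> R"
  shows "p < next_pos d R p" "next_pos d R p mod d \<in> R"
proof -
  \<comment> \<open>A full period returns to the residue of \<open>p\<close>, so
    \<open>s = d\<close> witnesses that the \<open>LEAST\<close> is attained.\<close>
  have "0 < d \<and> (p + d) mod d \<in> R" using assms by simp
  from LeastI[of "\<lambda>s. 0 < s \<and> (p + s) mod d \<in> R", OF this]
  show "p < next_pos d R p" "next_pos d R p mod d \<in> R"
    by (auto simp: next_pos_def)
qed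

lemma next_pos_le:
  assumes "p < q" "q mod d \<in> R"
  shows "next_pos d R p \<le> q"
proof -
  have "(LEAST s. 0 < s \<and> (p + s) mod d \<in> R) \<le> q - p"
    using assms by (intro Least_le) simp
  then show ?thesis using assms(1) by (simp add: next_pos_def)
qed

text \<open>If \<open>p < q\<close>, then \<open>q\<close> itself is a candidate for the successor
  of \<open>p\<close>, which is thus at most \<open>q\<close> and below the successor of
  \<open>q\<close>. Linearity of the order gives the converse.\<close>

lemma next_pos_less_iff:
  assumes "d \<ge> 1" "p mod d \<in> R" "q mod d \<in> R"
  shows "next_pos d R p < next_pos d R q \<longleftrightarrow> p < q"
proof -
  have "next_pos d R p < next_pos d R q" if "p < q" "q mod d \<in> R" for p q
    using next_pos_le[OF that] next_pos_props(1)[OF assms(1) that(2)] by simp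
  then show ?thesis using assms by (metis less_asym linorder_neqE_nat)
qed

lemma next_pos_commute:
  assumes d: "d \<ge> 1"
    and B: "B = (\<lambda>l. f l mod d) ` L" "B \<subseteq> A"
    and B': "B' = (\<lambda>l. next_pos d A (f l) mod d) ` L"
    and p: "p mod d \<in> B"
  shows "next_pos d B' (next_pos d A p) = next_pos d A (next_pos d B p)"
proof -
  have B'I: "next_pos d A q mod d \<in> B'" if q: "q mod d \<in> B" for q
  proof -
    obtain l where "l \<in> L" "q mod d = f l mod d" using q B by auto
    then show ?thesis using B' next_pos_mod_cong[of q d "f l" A] by auto
  qed
  show ?thesis
  proof (rule antisym)
    have q: "p < next_pos d B p" "next_pos d B p mod d \<in> B"
      using next_pos_props[OF d p] .
    have "next_pos d A p < next_pos d A (next_pos d B p)"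
      using next_pos_less_iff[OF d] p q B by blast
    then show "next_pos d B' (next_pos d A p) \<le> next_pos d A (next_pos d B p)"
      using next_pos_le B'I[OF q(2)] by blast
  next
    let ?q = "next_pos d B' (next_pos d A p)"
    have "next_pos d A p mod d \<in> B'" using B'I p .
    then have q: "next_pos d A p < ?q" "?q mod d \<in> B'"
      using next_pos_props[OF d] by blast+
    then obtain l where l: "l \<in> L" "?q mod d = next_pos d A (f l) mod d" using B' by auto
    \<comment> \<open>A \<open>B'\<close>-position is the \<open>A\<close>-successor of a
      \<open>B\<close>-position only up to periods. Adding periods on both sides avoids subtraction;
      the argument runs at \<open>p + t * d\<close>, and \<open>t * d\<close> cancels at the
      end.\<close>
    then obtain t u where "?q + t * d = next_pos d A (f l) + u * d"
      unfolding nat_mod_eq_iff by (auto simp: mult.commute)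
    then have r: "?q + t * d = next_pos d A (f l + u * d)"
      by (simp add: next_pos_add)
    have lB: "(f l + u * d) mod d \<in> B" using B l by simp
    have pB: "(p + t * d) mod d \<in> B" using p by simp
    have "next_pos d A (p + t * d) < next_pos d A (f l + u * d)"
      using q(1) r by (simp add: next_pos_add)
    then have "p + t * d < f l + u * d"
      using next_pos_less_iff[OF d] lB pB B(2) by blast
    then have "next_pos d B (p + t * d) \<le> f l + u * d"
      using next_pos_le lB by blast
    moreover have "next_pos d B (p + t * d) mod d \<in> B"
      using next_pos_props(2)[OF d pB] .
    ultimately have "next_pos d A (next_pos d B (p + t * d)) \<le> next_pos d A (f l + u * d)"
      using next_pos_less_iff[OF d] lB B(2) by (meson not_le subsetD)
    then show "next_pos d A (next_pos d B p) \<le> ?q"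
      using r by (simp add: next_pos_add)
  qed
qed

lemma delta_points:
  assumes "d \<ge> 1" "k \<in> {1..d}"
  shows "delta d x k \<in> points d"
  using assms delta_props(1)[of d x] Delta_points[of d x] by blast

text \<open>Seats start at 1, so \<open>seat_pos\<close> reads them off \<open>pos - 1\<close>; as
  \<open>pos\<close> is positive on \<open>points d\<close>, this only rotates the residues by
  one.\<close>

lemma seat_eq_iff_pos_mod:
  assumes "p \<in> points d" "q \<in> points d"
  shows "seat p = seat q \<longleftrightarrow> pos d p mod d = pos d q mod d"
proof
  have *: "pos d r - 1 + 1 = pos d r" if "r \<in> points d" for r
    using that by (auto simp: points_def pos_def)
  let ?p = "pos d p - 1" and ?q = "pos d q - 1"
  have "(?p + 1) mod d = (?q + 1) mod d" if "?p mod d = ?q mod d"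
    using that by (intro mod_add_cong) auto
  then show "pos d p mod d = pos d q mod d" if "seat p = seat q"
    using that seat_pos(1) assms unfolding *[OF assms(1)] *[OF assms(2)] by simp
  have "?p mod d = ?q mod d" if "(?p + 1) mod d = (?q + 1) mod d"
    using that by (rule add_mod_cancel)
  then show "seat p = seat q" if "pos d p mod d = pos d q mod d"
    using that seat_pos(1) assms unfolding *[OF assms(1)] *[OF assms(2)] by simp
qed

definition particle :: "nat \<Rightarrow> (nat \<Rightarrow> nat) \<Rightarrow> nat \<Rightarrow> nat" where
  "particle d x k = pos d (delta d x k)"

definition residues_from :: "nat \<Rightarrow> nat \<Rightarrow> (nat \<Rightarrow> nat) \<Rightarrow> nat set" where
  "residues_from d j x = (\<lambda>l. particle d x l mod d) ` {j..d}"

lemma particle_mod_bij: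
  assumes d: "d \<ge> 1"
  shows "bij_betw (\<lambda>k. particle d x k mod d) {1..d} {..<d}"
proof -
  have "inj_on (delta d x) {1..d}"
    using delta_props(1)[OF d, of x] by (intro eq_card_imp_inj_on) (simp_all add: card_Delta)
  moreover have "inj_on seat (Delta d x)"
    by (auto simp: Delta_def seat_def inj_on_def)
  ultimately have "inj_on (\<lambda>k. seat (delta d x k)) {1..d}"
    using comp_inj_on[of "delta d x" _ seat] delta_props(1)[OF d, of x] by (simp add: o_def)
  then have "inj_on (\<lambda>k. particle d x k mod d) {1..d}"
    using seat_eq_iff_pos_mod delta_points[OF d]
    unfolding inj_on_def particle_def by blast
  moreover from this have "(\<lambda>k. particle d x k mod d) ` {1..d} = {..<d}"
    using d by (intro card_subset_eq) (auto simp: card_image)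
  ultimately show ?thesis by (simp add: bij_betw_def)
qed

text \<open>The particles occupy each residue exactly once, so those from \<open>j\<close> on have
  the residues left free by the lower ones.\<close>

lemma residues_from_eq_Diff:
  assumes "d \<ge> 1" "1 \<le> j"
  shows "residues_from d j x = {..<d} - (\<lambda>l. particle d x l mod d) ` {l\<in>{1..d}. l < j}"
proof -
  let ?r = "\<lambda>k. particle d x k mod d" and ?I = "{l\<in>{1..d}. l < j}"
  have inj: "inj_on ?r {1..d}" and image: "?r ` {1..d} = {..<d}"
    using particle_mod_bij[OF assms(1)] by (simp_all add: bij_betw_def)
  have "?r ` ({1..d} - ?I) = ?r ` {1..d} - ?r ` ?I"
    by (rule inj_on_image_set_diff[OF inj]) auto
  moreover have "{j..d} = {1..d} - ?I" using assms by auto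
  ultimately show ?thesis unfolding residues_from_def image by simp
qed

text \<open>Equality of seats is congruence of positions, so \<open>step\<close> and
  \<open>next_pos\<close> minimise over the same set of shifts.\<close>

lemma particle_g:
  assumes d: "d \<ge> 1" and j: "1 \<le> j" "j \<le> d" and k: "1 \<le> k" "k \<le> d"
  shows "particle d (g d j x) k =
    (if k < j then particle d x k else next_pos d (residues_from d j x) (particle d x k))"
proof -
  have pk: "delta d x k \<in> points d" using delta_points d k by simp
  have "seat (shift d (delta d x k) s) \<in> (\<lambda>l. seat (delta d x l)) ` {j..d}
      \<longleftrightarrow> (particle d x k + s) mod d \<in> residues_from d j x" for s
  proof -
    have "seat (shift d (delta d x k) s) = seat (delta d x l)
        \<longleftrightarrow> (particle d x k + s) mod d = particle d x l mod d" if "l \<in> {j..d}" for l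
      using that j seat_eq_iff_pos_mod[OF shift_props(1)[OF d pk] delta_points[OF d]]
      by (simp add: shift_props(3)[OF d pk] particle_def)
    then show ?thesis unfolding residues_from_def by blast
  qed
  then show ?thesis
    unfolding particle_def g_props(3)[OF d j k] moved_def step_def next_pos_def
    by (simp add: shift_props(3)[OF d pk] particle_def)
qed

text \<open>The particles below \<open>i\<close> stay fixed since \<open>i \<le> j\<close>, and the
  complement of their residues is the set in question.\<close>

lemma residues_from_g:
  assumes "d \<ge> 1" "1 \<le> i" "i \<le> j" "j \<le> d"
  shows "residues_from d i (g d j x) = residues_from d i x"
proof -
  have "(\<lambda>l. particle d (g d j x) l mod d) ` {l\<in>{1..d}. l < i}
      = (\<lambda>l. particle d x l mod d) ` {l\<in>{1..d}. l < i}"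
    using assms by (intro image_cong) (simp_all add: particle_g)
  then show ?thesis using assms by (simp add: residues_from_eq_Diff)
qed

lemma tuples_eqI:
  assumes d: "d \<ge> 1" and t: "x \<in> tuples d" "y \<in> tuples d"
    and eq: "\<And>k. 1 \<le> k \<Longrightarrow> k \<le> d \<Longrightarrow> particle d x k = particle d y k"
  shows "x = y"
proof -
  have "delta d x k = delta d y k" if "k \<in> {1..d}" for k
    using that eq[of k] delta_points[OF d that]
    by (intro inj_onD[OF inj_on_pos[of d]]) (simp_all add: particle_def)
  then have "Delta d x = Delta d y"
    unfolding delta_props(1)[OF d, symmetric] by (intro image_cong) auto
  then have "x i = y i" if "i \<in> {1..d}" for i
    using that by (auto simp: Delta_def)
  then show ?thesis
    using t unfolding tuples_def by (intro PiE_ext)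
qed

theorem theorem4p1:
  fixes d j j' :: nat and x :: "nat \<Rightarrow> nat"
  assumes "d \<ge> 1"
    and "x \<in> tuples d"
    and "1 \<le> j'" and "j' < j" and "j \<le> d"
  shows "g d j' (g d j x) = g d j (g d j' x)"
proof (rule tuples_eqI[OF assms(1)])
  note d = assms(1) and j = assms(3-5)
  show "g d j' (g d j x) \<in> tuples d" "g d j (g d j' x) \<in> tuples d"
    using g_props(1)[OF d] j by simp_all
  let ?A = "residues_from d j' x" and ?B = "residues_from d j x"
  have B': "residues_from d j (g d j' x) = (\<lambda>l. next_pos d ?A (particle d x l) mod d) ` {j..d}"
    unfolding residues_from_def[of d j "g d j' x"] using d j
    by (intro image_cong) (simp_all add: particle_g)
  have sub: "?B \<subseteq> ?A" using j by (auto simp: residues_from_def)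
  fix k assume k: "1 \<le> k" "k \<le> d"
  have A: "residues_from d j' (g d j x) = ?A" using d j by (simp add: residues_from_g)
  show "particle d (g d j' (g d j x)) k = particle d (g d j (g d j' x)) k"
  proof (cases "k < j")
    case True
    \<comment> \<open>Here \<open>g d j\<close> fixes particle \<open>k\<close>, so both sides
      reduce to the action of \<open>g d j'\<close> with the same residue set
      \<open>?A\<close>.\<close>
    then show ?thesis using d j k by (simp add: particle_g A)
  next
    case False
    then have "particle d x k mod d \<in> ?B" using k by (simp add: residues_from_def)
    from next_pos_commute[OF d residues_from_def sub B' this]
    show ?thesis using False d j k by (simp add: particle_g A)
  qed
qed

end
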